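(* Every shape schema that does not use closure constraints $\mathit{closed}(R)$ is equivalent (i.e., has exactly the same class of conforming graphs) to a target-based shape schema that also does not use closure constraints.
   Context: Fix two disjoint infinite sets $N$ (node names, also called constants) and $P$ (property names). Path expressions are given by $E ::= \mathit{id} \mid p \mid p^- \mid E\cup E \mid E\circ E \mid E^*$ with $p\in P$. Shapes are given by $\phi ::= \top \mid \{c\} \mid \phi\land\phi \mid \phi\lor\phi \mid \neg\phi \mid {\geq_n E}.\phi \mid \mathit{eq}(E,p) \mid \mathit{disj}(E,p) \mid \mathit{closed}(R)$, where $c\in N$, $n\geq 1$ is an integer, $p\in P$, and $R$ is a finite subset of $P$; $\exists E.\phi$ abbreviates ${\geq_1 E}.\phi$. A graph $G$ is a finite set of triples $(a,p,b)$ with $a,b\in N$, $p\in P$. Semantics on $G$ (domain $N$): $[\![p]\!]^G=\{(a,b):(a,p,b)\in G\}$, $[\![\mathit{id}]\!]^G$ is the identity relation on $N$, $p^-$ is the inverse, $\cup$ is union, $\circ$ is composition, $E^*$ is the reflexive-transitive closure on $N$. For a binary relation $R$, $R(x)=\{y:(x,y)\in R\}$. $G,a\models\top$ always; $G,a\models\{c\}$ iff $a=c$; boolean connectives as usual; $G,a\models {\geq_n E}.\psi$ iff at least $n$ elements $b\in[\![E]\!]^G(a)$ satisfy $G,b\models\psi$; $G,a\models\mathit{eq}(E,p)$ iff $[\![E]\!]^G(a)=[\![p]\!]^G(a)$; $G,a\models\mathit{disj}(E,p)$ iff these sets are disjoint; $G,a\models\mathit{closed}(R)$ iff $[\![p]\!]^G(a)=\emptyset$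 for every $p\in P\setminus R$. $[\![\phi]\!]^G=\{a\in N:G,a\models\phi\}$. A shape schema is a finite set of inclusions $\phi_1\subseteq\phi_2$ of shapes; $G$ conforms to it if $[\![\phi_1]\!]^G\subseteq[\![\phi_2]\!]^G$ for each inclusion. Targets are shapes of the forms $\{c\}$ ($c\in N$), $\exists\,\mathsf{type}\circ\mathsf{subclass}^*.\{c\}$ (for fixed distinguished property names $\mathsf{type},\mathsf{subclass}$ and $c\in N$), $\exists p.\top$, and $\exists p^-.\top$ ($p\in P$). A shape schema is target-based if the left-hand side of each of its inclusions is a target. *)

theory Defs
  imports Main
begin

text \<open>
  Node names (constants) are the elements of the type \<open>'n\<close> and property names those of
  the type \<open>'p\<close>; being separate types they are disjoint. That both are infinite is assumed
  where needed.
\<close>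

datatype 'p path =
    PId
  | Prop 'p
  | Inverse 'p
  | Alt "'p path" "'p path"
  | Comp "'p path" "'p path"
  | Star "'p path"

datatype ('n, 'p) shape =
    Top
  | Const 'n
  | And "('n, 'p) shape" "('n, 'p) shape"
  | Or "('n, 'p) shape" "('n, 'p) shape"
  | Neg "('n, 'p) shape"
  | AtLeast nat "'p path" "('n, 'p) shape"
  | Eq "'p path" 'p
  | Disj "'p path" 'p
  | Closed "'p set"

text \<open>The datatype is slightly too generous: the counting bound in \<open>AtLeast\<close> has to be
  positive, and the argument of \<open>Closed\<close> has to be finite.\<close>

primrec wf_shape :: "('n, 'p) shape \<Rightarrow> bool" where
  "wf_shape Top \<longleftrightarrow> True"
| "wf_shape (Const c) \<longleftrightarrow> True"
| "wf_shape (And \<phi> \<psi>) \<longleftrightarrow> wf_shape \<phi> \<and> wf_shape \<psi>"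
| "wf_shape (Or \<phi> \<psi>) \<longleftrightarrow> wf_shape \<phi> \<and> wf_shape \<psi>"
| "wf_shape (Neg \<phi>) \<longleftrightarrow> wf_shape \<phi>"
| "wf_shape (AtLeast n E \<phi>) \<longleftrightarrow> 1 \<le> n \<and> wf_shape \<phi>"
| "wf_shape (Eq E p) \<longleftrightarrow> True"
| "wf_shape (Disj E p) \<longleftrightarrow> True"
| "wf_shape (Closed R) \<longleftrightarrow> finite R"

primrec closure_free :: "('n, 'p) shape \<Rightarrow> bool" where
  "closure_free Top \<longleftrightarrow> True"
| "closure_free (Const c) \<longleftrightarrow> True"
| "closure_free (And \<phi> \<psi>) \<longleftrightarrow> closure_free \<phi> \<and> closure_free \<psi>"
| "closure_free (Or \<phi> \<psi>) \<longleftrightarrow> closure_free \<phi> \<and> closure_free \<psi>"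
| "closure_free (Neg \<phi>) \<longleftrightarrow> closure_free \<phi>"
| "closure_free (AtLeast n E \<phi>) \<longleftrightarrow> closure_free \<phi>"
| "closure_free (Eq E p) \<longleftrightarrow> True"
| "closure_free (Disj E p) \<longleftrightarrow> True"
| "closure_free (Closed R) \<longleftrightarrow> False"

abbreviation Exists :: "'p path \<Rightarrow> ('n, 'p) shape \<Rightarrow> ('n, 'p) shape" where
  "Exists E \<phi> \<equiv> AtLeast 1 E \<phi>"

text \<open>Graphs are the finite sets of this type.\<close>

type_synonym ('n, 'p) triples = "('n \<times> 'p \<times> 'n) set"

primrec path_sem :: "('n, 'p) triples \<Rightarrow> 'p path \<Rightarrow> ('n \<times> 'n) set" where
  "path_sem G PId = Id"
| "path_sem G (Prop p) = {(a, b). (a, p, b) \<in> G}"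
| "path_sem G (Inverse p) = {(a, b). (a, p, b) \<in> G}\<inverse>"
| "path_sem G (Alt E F) = path_sem G E \<union> path_sem G F"
| "path_sem G (Comp E F) = path_sem G E O path_sem G F"
| "path_sem G (Star E) = (path_sem G E)\<^sup>*"

text \<open>"At least \<open>n\<close> elements" is phrased through a finite subset of size \<open>n\<close>, so that it
  does not rely on \<open>card\<close> of a possibly infinite set.\<close>

primrec sat :: "('n, 'p) triples \<Rightarrow> 'n \<Rightarrow> ('n, 'p) shape \<Rightarrow> bool" where
  "sat G a Top \<longleftrightarrow> True"
| "sat G a (Const c) \<longleftrightarrow> a = c"
| "sat G a (And \<phi> \<psi>) \<longleftrightarrow> sat G a \<phi> \<and> sat G a \<psi>"
| "sat G a (Or \<phi> \<psi>) \<longleftrightarrow> sat G a \<phi> \<or> sat G a \<psi>"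
| "sat G a (Neg \<phi>) \<longleftrightarrow> \<not> sat G a \<phi>"
| "sat G a (AtLeast n E \<phi>) \<longleftrightarrow>
     (\<exists>B. finite B \<and> card B = n \<and> B \<subseteq> {b \<in> path_sem G E `` {a}. sat G b \<phi>})"
| "sat G a (Eq E p) \<longleftrightarrow> path_sem G E `` {a} = path_sem G (Prop p) `` {a}"
| "sat G a (Disj E p) \<longleftrightarrow> path_sem G E `` {a} \<inter> path_sem G (Prop p) `` {a} = {}"
| "sat G a (Closed R) \<longleftrightarrow> (\<forall>p. p \<notin> R \<longrightarrow> path_sem G (Prop p) `` {a} = {})"

definition shape_sem :: "('n, 'p) triples \<Rightarrow> ('n, 'p) shape \<Rightarrow> 'n set" where
  "shape_sem G \<phi> = {a. sat G a \<phi>}"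

text \<open>A pair \<open>(\<phi>, \<psi>)\<close> stands for the inclusion \<open>\<phi> \<subseteq> \<psi>\<close>.\<close>

type_synonym ('n, 'p) inclusions = "(('n, 'p) shape \<times> ('n, 'p) shape) set"

definition shape_schema :: "('n, 'p) inclusions \<Rightarrow> bool" where
  "shape_schema S \<longleftrightarrow> finite S \<and> (\<forall>(\<phi>, \<psi>) \<in> S. wf_shape \<phi> \<and> wf_shape \<psi>)"

definition closure_free_schema :: "('n, 'p) inclusions \<Rightarrow> bool" where
  "closure_free_schema S \<longleftrightarrow> (\<forall>(\<phi>, \<psi>) \<in> S. closure_free \<phi> \<and> closure_free \<psi>)"

definition conforms :: "('n, 'p) triples \<Rightarrow> ('n, 'p) inclusions \<Rightarrow> bool" where
  "conforms G S \<longleftrightarrow> (\<forall>(\<phi>, \<psi>) \<in> S. shape_sem G \<phi> \<subseteq> shape_sem G \<psi>)"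

definition schema_equiv :: "('n, 'p) inclusions \<Rightarrow> ('n, 'p) inclusions \<Rightarrow> bool" where
  "schema_equiv S S' \<longleftrightarrow> (\<forall>G. finite G \<longrightarrow> (conforms G S \<longleftrightarrow> conforms G S'))"

text \<open>The parameters \<open>ty\<close> and \<open>sc\<close> are the distinguished property names \<open>type\<close> and
  \<open>subclass\<close>.\<close>

inductive is_target :: "'p \<Rightarrow> 'p \<Rightarrow> ('n, 'p) shape \<Rightarrow> bool" for ty sc :: 'p where
  node: "is_target ty sc (Const c)"
| class_based: "is_target ty sc (Exists (Comp (Prop ty) (Star (Prop sc))) (Const c))"
| subjects_of: "is_target ty sc (Exists (Prop p) Top)"
| objects_of: "is_target ty sc (Exists (Inverse p) Top)"

definition target_based :: "'p \<Rightarrow> 'p \<Rightarrow> ('n, 'p) inclusions \<Rightarrow> bool" where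
  "target_based ty sc S \<longleftrightarrow> (\<forall>(\<phi>, \<psi>) \<in> S. is_target ty sc \<phi>)"

end

theory Submission
  imports Defs
begin

text \<open>
  A schema asserts that every node satisfies a single shape \<open>\<chi>\<close>. Without closure constraints, a
  node that is not a constant of \<open>\<chi>\<close> and has no edge labelled with a property of \<open>\<chi>\<close> can reach
  at most itself, so whether it satisfies \<open>\<chi>\<close> depends neither on the node nor on the graph. As
  graphs are finite and there are infinitely many nodes, such nodes always exist. If they violate
  \<open>\<chi>\<close>, no graph conforms; otherwise it suffices to check \<open>\<chi>\<close> at the remaining nodes, which are
  covered by the finitely many targets \<open>{c}\<close>, \<open>\<exists>p.\<top>\<close> and \<open>\<exists>p\<^sup>-.\<top>\<close> for the names occurring in \<open>\<chi>\<close>.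
\<close>

primrec shape_consts :: "('n, 'p) shape \<Rightarrow> 'n set" where
  "shape_consts Top = {}"
| "shape_consts (Const c) = {c}"
| "shape_consts (And \<phi> \<psi>) = shape_consts \<phi> \<union> shape_consts \<psi>"
| "shape_consts (Or \<phi> \<psi>) = shape_consts \<phi> \<union> shape_consts \<psi>"
| "shape_consts (Neg \<phi>) = shape_consts \<phi>"
| "shape_consts (AtLeast n E \<phi>) = shape_consts \<phi>"
| "shape_consts (Eq E p) = {}"
| "shape_consts (Disj E p) = {}"
| "shape_consts (Closed R) = {}"

primrec shape_props :: "('n, 'p) shape \<Rightarrow> 'p set" where
  "shape_props Top = {}"
| "shape_props (Const c) = {}"
| "shape_props (And \<phi> \<psi>) = shape_props \<phi> \<union> shape_props \<psi>"
| "shape_props (Or \<phi> \<psi>) = shape_props \<phi> \<union> shape_props \<psi>"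
| "shape_props (Neg \<phi>) = shape_props \<phi>"
| "shape_props (AtLeast n E \<phi>) = set_path E \<union> shape_props \<phi>"
| "shape_props (Eq E p) = insert p (set_path E)"
| "shape_props (Disj E p) = insert p (set_path E)"
| "shape_props (Closed R) = R"

text \<open>The regular-language notion: the empty word belongs to the language of the path
  expression. Such a path can be followed without using any edge.\<close>

primrec nullable :: "'p path \<Rightarrow> bool" where
  "nullable PId \<longleftrightarrow> True"
| "nullable (Prop p) \<longleftrightarrow> False"
| "nullable (Inverse p) \<longleftrightarrow> False"
| "nullable (Alt E F) \<longleftrightarrow> nullable E \<or> nullable F"
| "nullable (Comp E F) \<longleftrightarrow> nullable E \<and> nullable F"
| "nullable (Star E) \<longleftrightarrow> True"

text \<open>Incoming edges are excluded too, since paths may use inverses. Edges labelled outside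
  \<open>P\<close> remain allowed.\<close>

definition isolated :: "('n, 'p) triples \<Rightarrow> 'p set \<Rightarrow> 'n \<Rightarrow> bool" where
  "isolated G P a \<longleftrightarrow> (\<forall>p\<in>P. \<forall>b. (a, p, b) \<notin> G \<and> (b, p, a) \<notin> G)"

lemma isolated_Un [simp]: "isolated G (P \<union> Q) a \<longleftrightarrow> isolated G P a \<and> isolated G Q a"
  by (auto simp: isolated_def)

lemma isolated_insert [simp]:
  "isolated G (insert p P) a \<longleftrightarrow>
    (\<forall>b. (a, p, b) \<notin> G \<and> (b, p, a) \<notin> G) \<and> isolated G P a"
  by (auto simp: isolated_def)

lemma finite_shape_consts [simp]: "finite (shape_consts \<phi>)"
  by (induction \<phi>) auto

lemma finite_set_path [simp]: "finite (set_path E)"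
  by (induction E) auto

lemma finite_shape_props [simp]: "wf_shape \<phi> \<Longrightarrow> finite (shape_props \<phi>)"
  by (induction \<phi>) auto

lemma rtrancl_Image_subset_singleton:
  assumes "R `` {a} \<subseteq> {a}"
  shows "R\<^sup>* `` {a} = {a}"
proof -
  have "b = a" if "(a, b) \<in> R\<^sup>*" for b
    using that by (induction rule: rtrancl_induct) (use assms in auto)
  then show ?thesis by auto
qed

text \<open>At \<open>a\<close> every property step of \<open>E\<close>, forward or inverse, is
  blocked, so a path never leaves \<open>a\<close> and only the empty word can be followed.\<close>

lemma path_sem_isolated:
  "isolated G (set_path E) a \<Longrightarrow>
    path_sem G E `` {a} = (if nullable E then {a} else {})"
proof (induction E)
  case (Star E)
  then show ?case by (simp add: rtrancl_Image_subset_singleton)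
qed (auto simp: isolated_def relcomp_Image Un_Image)

lemma ex_finite_card_subset_singleton:
  "(\<exists>B. finite B \<and> card B = n \<and> B \<subseteq> {b \<in> {a}. P b}) \<longleftrightarrow> n = 0 \<or> n = 1 \<and> P a"
proof
  assume "\<exists>B. finite B \<and> card B = n \<and> B \<subseteq> {b \<in> {a}. P b}"
  then obtain B where "card B = n" "B \<subseteq> {a}" "B \<subseteq> Collect P" by auto
  then show "n = 0 \<or> n = 1 \<and> P a" by (auto simp: subset_singleton_iff)
next
  assume "n = 0 \<or> n = 1 \<and> P a"
  then show "\<exists>B. finite B \<and> card B = n \<and> B \<subseteq> {b \<in> {a}. P b}"
    by (intro exI[of _ "if n = 0 then {} else {a}"]) auto
qed

text \<open>Paths from an isolated node lead at most back to it, so in the case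
  \<open>AtLeast\<close> the induction hypothesis is needed only at \<open>a\<close> and
  \<open>b\<close> themselves. For \<open>Eq\<close> and \<open>Disj\<close> the
  \<open>p\<close>-successors are empty and nullability of \<open>E\<close> decides. A shape
  \<open>Closed R\<close> would see edges outside \<open>shape_props\<close>, hence
  \<open>closure_free\<close>.\<close>

lemma sat_isolated_cong:
  assumes "closure_free \<phi>"
    and "a \<notin> shape_consts \<phi>" "isolated G (shape_props \<phi>) a"
    and "b \<notin> shape_consts \<phi>" "isolated H (shape_props \<phi>) b"
  shows "sat G a \<phi> \<longleftrightarrow> sat H b \<phi>"
  using assms
proof (induction \<phi>)
  case (AtLeast n E \<phi>)
  show ?case
  proof (cases "nullable E")
    case True
    then have "path_sem G E `` {a} = {a}" "path_sem H E `` {b} = {b}"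
      using AtLeast.prems by (simp_all add: path_sem_isolated)
    then show ?thesis
      using AtLeast by (simp only: sat.simps ex_finite_card_subset_singleton) simp
  next
    case False
    then have "path_sem G E `` {a} = {}" "path_sem H E `` {b} = {}"
      using AtLeast.prems by (simp_all add: path_sem_isolated)
    then show ?thesis by (simp only: sat.simps) simp
  qed
qed (auto simp: path_sem_isolated)

text \<open>Any node outside \<open>C\<close> that is no endpoint of a triple of \<open>G\<close>
  will do, whatever \<open>P\<close> is.\<close>

lemma ex_fresh_isolated:
  fixes G :: "('n, 'p) triples"
  assumes "infinite (UNIV :: 'n set)" "finite G" "finite C"
  shows "\<exists>a. a \<notin> C \<and> isolated G P a"
proof -
  have "finite (C \<union> fst ` G \<union> (snd \<circ> snd) ` G)" (is "finite ?A")
    using assms by simp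
  then obtain a where "a \<notin> ?A"
    using ex_new_if_finite[OF assms(1)] by metis
  then show ?thesis by (force simp: isolated_def)
qed

lemma sat_Exists: "sat G a (Exists E \<phi>) \<longleftrightarrow> (\<exists>b. (a, b) \<in> path_sem G E \<and> sat G b \<phi>)"
proof
  assume "sat G a (Exists E \<phi>)"
  then obtain B where "card B = 1" "B \<subseteq> {b \<in> path_sem G E `` {a}. sat G b \<phi>}" by auto
  then show "\<exists>b. (a, b) \<in> path_sem G E \<and> sat G b \<phi>" by (auto simp: card_1_singleton_iff)
next
  assume "\<exists>b. (a, b) \<in> path_sem G E \<and> sat G b \<phi>"
  then obtain b where "(a, b) \<in> path_sem G E" "sat G b \<phi>" by blast
  then show "sat G a (Exists E \<phi>)" by (simp add: exI[of _ "{b}"])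
qed

lemma ex_target_based_valid:
  fixes ty sc :: 'p and \<chi> :: "('n, 'p) shape"
  assumes inf: "infinite (UNIV :: 'n set)" and wf: "wf_shape \<chi>" and cf: "closure_free \<chi>"
  shows "\<exists>S :: ('n, 'p) inclusions.
    shape_schema S \<and> target_based ty sc S \<and> closure_free_schema S \<and>
    (\<forall>G. finite G \<longrightarrow> (conforms G S \<longleftrightarrow> (\<forall>a. sat G a \<chi>)))"
proof -
  \<comment> \<open>In the empty graph every node is isolated, so \<open>c\<close> serves there as
    the reference point: its truth value for \<open>\<chi>\<close> is that of every isolated
    non-constant node of any graph.\<close>
  obtain c where c: "c \<notin> shape_consts \<chi>"
    using ex_new_if_finite[OF inf finite_shape_consts] by blast
  have iso: "isolated {} (shape_props \<chi>) c" by (simp add: isolated_def)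
  show ?thesis
  proof (cases "sat {} c \<chi>")
    case True
    define T where "T = Const ` shape_consts \<chi>
      \<union> (\<lambda>p. Exists (Prop p) Top) ` shape_props \<chi>
      \<union> (\<lambda>p. Exists (Inverse p) Top) ` shape_props \<chi>"
    define S where "S = T \<times> {\<chi>}"
    have "finite T" using wf by (simp add: T_def)
    moreover have "wf_shape t" "closure_free t" "is_target ty sc t" if "t \<in> T" for t
      using that by (auto simp: T_def intro: is_target.intros simp del: One_nat_def)
    ultimately have "shape_schema S" "target_based ty sc S" "closure_free_schema S"
      using wf cf
      by (auto simp: S_def shape_schema_def target_based_def closure_free_schema_def)
    moreover have "conforms G S \<longleftrightarrow> (\<forall>a. sat G a \<chi>)" for G
    proof
      assume "conforms G S"
      then have at_target: "sat G a \<chi>" if "t \<in> T" "sat G a t" for a t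
        using that by (auto simp: conforms_def S_def shape_sem_def)
      show "\<forall>a. sat G a \<chi>"
      proof
        fix a
        show "sat G a \<chi>"
        proof (cases "a \<notin> shape_consts \<chi> \<and> isolated G (shape_props \<chi>) a")
          case True
          then show ?thesis using sat_isolated_cong[OF cf _ _ c iso] \<open>sat {} c \<chi>\<close> by blast
        next
          case False
          \<comment> \<open>Either \<open>a\<close> is a constant of \<open>\<chi>\<close>, or an
            edge leaving or entering it has a label in \<open>shape_props \<chi>\<close>; each case
            matches one part of \<open>T\<close>. The deleted simp rules would destroy the pattern
            of \<open>sat_Exists\<close>.\<close>
          then have "\<exists>t\<in>T. sat G a t"
            by (auto simp: T_def isolated_def bex_Un sat_Exists
                simp del: sat.simps(6) One_nat_def)
          then show ?thesis using at_target by blast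
        qed
      qed
    qed (auto simp: conforms_def S_def shape_sem_def)
    ultimately show ?thesis by blast
  next
    case False
    \<comment> \<open>An inclusion violated at \<open>c\<close> in every graph.\<close>
    define S :: "('n, 'p) inclusions" where "S = {(Const c, Neg Top)}"
    have "shape_schema S" "target_based ty sc S" "closure_free_schema S"
      by (auto simp: S_def shape_schema_def target_based_def closure_free_schema_def
          intro: is_target.intros)
    moreover have "\<not> conforms G S" for G
      by (simp add: S_def conforms_def shape_sem_def)
    moreover have "\<exists>a. \<not> sat G a \<chi>" if "finite G" for G
      using ex_fresh_isolated[OF inf that finite_shape_consts]
        sat_isolated_cong[OF cf _ _ c iso] False by blast
    ultimately show ?thesis by blast
  qed
qed

text \<open>An inclusion of \<open>\<phi>\<close> in \<open>\<psi>\<close> says that all nodes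
  satisfy \<open>Or (Neg \<phi>) \<psi>\<close>; \<open>\<chi>\<close> is the conjunction of these
  shapes over the finite schema.\<close>

lemma ex_shape_conforms:
  assumes "finite S" "shape_schema S" "closure_free_schema S"
  shows "\<exists>\<chi>. wf_shape \<chi> \<and> closure_free \<chi> \<and> (\<forall>G. conforms G S \<longleftrightarrow> (\<forall>a. sat G a \<chi>))"
  using assms
proof (induction S rule: finite_induct)
  case empty
  show ?case by (rule exI[of _ Top]) (simp add: conforms_def)
next
  case (insert i S)
  obtain \<phi> \<psi> where i: "i = (\<phi>, \<psi>)" by fastforce
  obtain \<chi> where "wf_shape \<chi>" "closure_free \<chi>" "\<And>G. conforms G S \<longleftrightarrow> (\<forall>a. sat G a \<chi>)"
    using insert by (auto simp: shape_schema_def closure_free_schema_def)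
  then show ?case
    using insert.prems
    by (intro exI[of _ "And (Or (Neg \<phi>) \<psi>) \<chi>"])
      (auto simp: i shape_schema_def closure_free_schema_def conforms_def shape_sem_def)
qed

theorem theorem4p1:
  fixes ty sc :: 'p
    and S :: "('n, 'p) inclusions"
  assumes "infinite (UNIV :: 'n set)"
    and "infinite (UNIV :: 'p set)"
    and "shape_schema S"
    and "closure_free_schema S"
  shows "\<exists>S' :: ('n, 'p) inclusions.
    shape_schema S' \<and> target_based ty sc S' \<and> closure_free_schema S' \<and> schema_equiv S S'"
proof -
  obtain \<chi> where \<chi>: "wf_shape \<chi>" "closure_free \<chi>"
    "\<And>G. conforms G S \<longleftrightarrow> (\<forall>a. sat G a \<chi>)"
    using ex_shape_conforms assms by (metis shape_schema_def)
  then show ?thesis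
    using ex_target_based_valid[OF assms(1) \<chi>(1,2), of ty sc]
    by (auto simp: schema_equiv_def)
qed

end
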